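(* For any $h\ge 0$, problem $P(\overline{g}_1,f_{12},h)$ is feasible if and only if $\min\{\overline{g}_1,f_{12}\}\ge f_{\min}$, where $$f_{\min}=\max\left\{\max_{1\le t\le T}\left(\frac{\sum_{\tau=1}^{t}d_2(\tau)}{t}\right),\ \max_{1\le t_1<t_2\le T}\left(\frac{\sum_{\tau=t_1+1}^{t_2}d_2(\tau)-h}{t_2-t_1}\right)\right\}.$$ Moreover, if $\min\{\overline{g}_1,f_{12}\}\ge f_{\min}$, then $p_*(\overline{g}_1,f_{12},h)=p_*(f_{\min},f_{\min},h)$.
   Context: Single generator single load network: a generator at bus 1 (no demand) with generation capacity $\overline{g}_1\ge0$ is connected by one line of capacity $f_{12}\ge 0$ to a load at bus 2 (no generation) with given demand profile $d_2(t)\ge 0$, $t\in[T]=\{1,\dots,T\}$. The generation cost $c_1:[0,\infty)\to[0,\infty)$ is nondecreasing and strictly convex. Storage is perfectly efficient and ramp constraints are ignored (charging/discharging efficiencies and ramp constants all equal to 1). Problem $P(\overline{g}_1,f_{12},h)$, with storage budget $h\ge0$: minimize $\sum_{t=1}^Tc_1(g_1(t))$ over real $g_1(t)$, $r_1(t)$, $r_2(t)$, $b_1,b_2$ ($t\in[T]$), where $r_k(t)$ is the net power flowing into the storage at bus $k$ (charging minus discharging), subject to, for $t\in[T]$ and $k=1,2$: $0\le g_1(t)\le\overline{g}_1$; the power sent from bus 1 to bus 2 satisfies $p_{12}(t)=g_1(t)-r_1(t)=d_2(t)+r_2(t)$ and $|p_{12}(t)|\le f_{12}$; $0\le s_k(t)\le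 b_k$ where $s_k(t)=\sum_{\tau=1}^tr_k(\tau)$; $s_k(T)=0$; $b_1,b_2\ge 0$ and $b_1+b_2\le h$. Its optimal value is $p_*(\overline{g}_1,f_{12},h)$. If $T=1$ the second maximum in the formula for $f_{\min}$ is over an empty set and is omitted. *)

theory Defs
  imports "HOL-Analysis.Analysis"
begin

definition strictly_convex_on :: "real set \<Rightarrow> (real \<Rightarrow> real) \<Rightarrow> bool" where
  "strictly_convex_on S c \<longleftrightarrow> convex S \<and>
     (\<forall>x\<in>S. \<forall>y\<in>S. \<forall>u. x \<noteq> y \<longrightarrow> 0 < u \<longrightarrow> u < 1 \<longrightarrow>
        c ((1 - u) * x + u * y) < (1 - u) * c x + u * c y)"

text \<open>Periods are the naturals in \<open>{1..T}\<close>; values of \<open>d2\<close>, \<open>g1\<close>, \<open>r1\<close>, \<open>r2\<close> at other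
  arguments are never used.\<close>

definition storage_level :: "(nat \<Rightarrow> real) \<Rightarrow> nat \<Rightarrow> real" where
  "storage_level r t = (\<Sum>\<tau>=1..t. r \<tau>)"

definition storage_ok :: "nat \<Rightarrow> (nat \<Rightarrow> real) \<Rightarrow> real \<Rightarrow> bool" where
  "storage_ok T r b \<longleftrightarrow>
     (\<forall>t\<in>{1..T}. 0 \<le> storage_level r t \<and> storage_level r t \<le> b) \<and> storage_level r T = 0"

type_synonym decision = "(nat \<Rightarrow> real) \<times> (nat \<Rightarrow> real) \<times> (nat \<Rightarrow> real) \<times> real \<times> real"

text \<open>A decision is \<open>(g1, r1, r2, b1, b2)\<close>; the power sent over the line is \<open>g1 t - r1 t\<close>.\<close>

definition feasible_set ::
  "nat \<Rightarrow> (nat \<Rightarrow> real) \<Rightarrow> real \<Rightarrow> real \<Rightarrow> real \<Rightarrow> decision set" where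
  "feasible_set T d2 gbar1 f12 h =
     {(g1, r1, r2, b1, b2).
        (\<forall>t\<in>{1..T}. 0 \<le> g1 t \<and> g1 t \<le> gbar1) \<and>
        (\<forall>t\<in>{1..T}. g1 t - r1 t = d2 t + r2 t \<and> \<bar>g1 t - r1 t\<bar> \<le> f12) \<and>
        storage_ok T r1 b1 \<and> storage_ok T r2 b2 \<and>
        0 \<le> b1 \<and> 0 \<le> b2 \<and> b1 + b2 \<le> h}"

definition feasible :: "nat \<Rightarrow> (nat \<Rightarrow> real) \<Rightarrow> real \<Rightarrow> real \<Rightarrow> real \<Rightarrow> bool" where
  "feasible T d2 gbar1 f12 h \<longleftrightarrow> feasible_set T d2 gbar1 f12 h \<noteq> {}"

text \<open>Extended-real valued, so that an infeasible problem has optimal value \<open>\<infinity>\<close>.\<close>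

definition opt_value ::
  "nat \<Rightarrow> (nat \<Rightarrow> real) \<Rightarrow> (real \<Rightarrow> real) \<Rightarrow> real \<Rightarrow> real \<Rightarrow> real \<Rightarrow> ereal" where
  "opt_value T d2 c1 gbar1 f12 h =
     (INF (g1, r1, r2, b1, b2) \<in> feasible_set T d2 gbar1 f12 h. ereal (\<Sum>t=1..T. c1 (g1 t)))"

definition f_min :: "nat \<Rightarrow> (nat \<Rightarrow> real) \<Rightarrow> real \<Rightarrow> real" where
  "f_min T d2 h =
     (let A = {(\<Sum>\<tau>=1..t. d2 \<tau>) / real t | t. 1 \<le> t \<and> t \<le> T};
          B = {((\<Sum>\<tau>=t1+1..t2. d2 \<tau>) - h) / real (t2 - t1) | t1 t2. 1 \<le> t1 \<and> t1 < t2 \<and> t2 \<le> T}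
      in if B = {} then Max A else max (Max A) (Max B))"

end

theory Submission
  imports Defs
begin

text \<open>
  Only the total storage level matters: with \<open>G\<close> and \<open>D\<close> the cumulative generation and demand,
  a feasible decision gives a nondecreasing path \<open>G\<close> in the tube \<open>D \<le> G \<le> D + h\<close> from \<open>0\<close> to
  \<open>D T\<close>, and the bounds defining \<open>f_min\<close> say that the tube contains such a path of slope at most
  the capacity. Put \<open>m = f_min\<close> and let \<open>L t = max\<^bsub>s\<ge>t\<^esub> (D s - m (s - t))\<close> be the least path of
  slope at most \<open>m\<close> above \<open>D\<close>. Given any path \<open>G\<close> in the tube, the greatest path \<open>K\<close> of slope at
  most \<open>m\<close> below \<open>max G L\<close> stays in the tube. It has slope \<open>m\<close> just before each time at which
  \<open>K < G\<close> and just after each time at which \<open>K > G\<close>, so summation by parts against a subgradient of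
  the convex cost shows that \<open>K\<close> costs no more than \<open>G\<close>. Since \<open>K\<close> never exceeds the capacity \<open>m\<close>,
  all storage can be placed at the load.
\<close>

section \<open>Cumulative sums and summation by parts\<close>

lemma sum_by_parts:
  fixes a e :: "nat \<Rightarrow> real"
  assumes "e 0 = 0"
  shows "(\<Sum>t<Suc n. a t * (e (Suc t) - e t)) =
    a n * e (Suc n) + (\<Sum>t<n. (a t - a (Suc t)) * e (Suc t))"
  using assms by (induction n) (simp_all add: algebra_simps)

lemma storage_level_0 [simp]: "storage_level r 0 = 0"
  by (simp add: storage_level_def)

lemma storage_level_Suc [simp]: "storage_level r (Suc t) = storage_level r t + r (Suc t)"
  by (simp add: storage_level_def)

lemma storage_level_increments:
  assumes "K 0 = 0"
  shows "storage_level (\<lambda>t. K t - K (t - 1)) t = K t"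
  using assms by (induction t) simp_all

lemma storage_level_add:
  "storage_level (\<lambda>t. f t + g t) t = storage_level f t + storage_level g t"
  by (simp add: storage_level_def sum.distrib)

lemma storage_level_diff:
  "storage_level (\<lambda>t. f t - g t) t = storage_level f t - storage_level g t"
  by (simp add: storage_level_def sum_subtractf)

lemma storage_level_cong:
  assumes "\<And>i. i \<in> {1..T} \<Longrightarrow> f i = g i" and "t \<le> T"
  shows "storage_level f t = storage_level g t"
  unfolding storage_level_def using assms by (intro sum.cong) auto

lemma sum_Suc_eq_storage_level_diff:
  assumes "s \<le> t"
  shows "(\<Sum>i=Suc s..t. f i) = storage_level f t - storage_level f s"
  using assms by (induction t rule: dec_induct) simp_all

lemma storage_level_diff_le:
  assumes "s \<le> t" and "\<And>i. i \<in> {s+1..t} \<Longrightarrow> f i \<le> x"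
  shows "storage_level f t - storage_level f s \<le> x * (real t - real s)"
proof -
  have "(\<Sum>i=s+1..t. f i) \<le> (\<Sum>i=s+1..t. x)"
    using assms(2) by (intro sum_mono) auto
  then show ?thesis
    using assms(1) by (simp add: sum_Suc_eq_storage_level_diff of_nat_diff mult.commute)
qed

section \<open>Slope bounds encoded by \<open>f_min\<close>\<close>

text \<open>Clearing denominators turns both maxima into bounds on increments of cumulative demand.
  A capacity \<open>x\<close> is compared with \<open>f_min\<close> through them, and
  \<open>x = f_min\<close> returns the bounds that \<open>f_min\<close> itself satisfies.\<close>

lemma f_min_le_iff:
  assumes "T \<ge> 1"
  shows "f_min T d2 h \<le> x \<longleftrightarrow>
    (\<forall>t\<in>{1..T}. storage_level d2 t \<le> x * real t) \<and>
    (\<forall>s t. 1 \<le> s \<longrightarrow> s < t \<longrightarrow> t \<le> T \<longrightarrow>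
       storage_level d2 t - storage_level d2 s - h \<le> x * (real t - real s))"
proof -
  let ?A = "{(\<Sum>\<tau>=1..t. d2 \<tau>) / real t | t. 1 \<le> t \<and> t \<le> T}"
  let ?B = "{((\<Sum>\<tau>=t1+1..t2. d2 \<tau>) - h) / real (t2 - t1) | t1 t2. 1 \<le> t1 \<and> t1 < t2 \<and> t2 \<le> T}"
  have A: "?A = (\<lambda>t. storage_level d2 t / real t) ` {1..T}"
    by (auto simp: storage_level_def)
  have B: "?B = (\<lambda>(s, t). (storage_level d2 t - storage_level d2 s - h) / (real t - real s)) `
      {(s, t). 1 \<le> s \<and> s < t \<and> t \<le> T}" (is "_ = ?g ` ?I")
  proof (intro equalityI subsetI)
    fix y assume "y \<in> ?B"
    then obtain s t where "1 \<le> s" "s < t" "t \<le> T"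
      "y = ((\<Sum>\<tau>=s+1..t. d2 \<tau>) - h) / real (t - s)" by blast
    then show "y \<in> ?g ` ?I"
      using sum_Suc_eq_storage_level_diff[of s t d2]
      by (intro image_eqI[where x = "(s, t)"]) (auto simp: of_nat_diff)
  next
    fix y assume "y \<in> ?g ` ?I"
    then obtain s t where st: "1 \<le> s" "s < t" "t \<le> T" and y: "y = ?g (s, t)" by blast
    then have "y = ((\<Sum>\<tau>=s+1..t. d2 \<tau>) - h) / real (t - s)"
      using sum_Suc_eq_storage_level_diff[of s t d2] by (simp add: of_nat_diff)
    with st show "y \<in> ?B" by blast
  qed
  have "finite ?I" by (rule finite_subset[of _ "{..T} \<times> {..T}"]) auto
  then have fin: "finite ?A" "finite ?B" unfolding A B by auto
  have ne: "?A \<noteq> {}" using assms unfolding A by auto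
  \<comment> \<open>The case split matters for \<open>T = 1\<close>, where there is no pair
    \<open>s < t\<close>.\<close>
  have "f_min T d2 h \<le> x \<longleftrightarrow> (\<forall>a\<in>?A. a \<le> x) \<and> (\<forall>b\<in>?B. b \<le> x)"
    using fin ne unfolding f_min_def Let_def by (cases "?B = {}")
      (simp_all only: Max_le_iff max.bounded_iff if_True if_False ball_simps simp_thms)
  also have "\<dots> \<longleftrightarrow> (\<forall>t\<in>{1..T}. storage_level d2 t / real t \<le> x) \<and> (\<forall>p\<in>?I. ?g p \<le> x)"
    unfolding A B by simp
  also have "\<dots> \<longleftrightarrow> (\<forall>t\<in>{1..T}. storage_level d2 t \<le> x * real t) \<and>
    (\<forall>s t. 1 \<le> s \<longrightarrow> s < t \<longrightarrow> t \<le> T \<longrightarrow>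
       storage_level d2 t - storage_level d2 s - h \<le> x * (real t - real s))"
    by (auto simp: pos_divide_le_eq)
  finally show ?thesis .
qed

lemma f_min_nonneg:
  assumes "T \<ge> 1" and "d2 1 \<ge> 0"
  shows "f_min T d2 h \<ge> 0"
proof -
  have "\<forall>t\<in>{1..T}. storage_level d2 t \<le> f_min T d2 h * real t"
    using f_min_le_iff[OF assms(1), of d2 h "f_min T d2 h"] by simp
  from bspec[OF this, of 1] show ?thesis using assms by (simp add: storage_level_def)
qed

section \<open>Slope-capped paths in the storage tube\<close>

text \<open>The last two properties are complementarity conditions: \<open>K\<close> departs from
  \<open>G\<close> only where the cap \<open>m\<close> is active. They carry the cost
  comparison.\<close>

lemma capped_path_in_tube:
  fixes D G :: "nat \<Rightarrow> real" and m h :: real and T :: nat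
  assumes m: "m \<ge> 0"
    and D0: "D 0 = 0" and D_mono: "\<And>t. t < T \<Longrightarrow> D t \<le> D (Suc t)"
    and cap0: "\<And>t. t \<le> T \<Longrightarrow> D t \<le> m * real t"
    and cap: "\<And>s t. s \<le> t \<Longrightarrow> t \<le> T \<Longrightarrow> D t - D s - h \<le> m * (real t - real s)"
    and G0: "G 0 = 0" and G_mono: "\<And>t. t < T \<Longrightarrow> G t \<le> G (Suc t)"
    and tube: "\<And>t. t \<le> T \<Longrightarrow> D t \<le> G t \<and> G t \<le> D t + h" and GT: "G T = D T"
  obtains K where "K 0 = 0" "K T = D T"
    "\<And>t. t < T \<Longrightarrow> 0 \<le> K (Suc t) - K t \<and> K (Suc t) - K t \<le> m"
    "\<And>t. t \<le> T \<Longrightarrow> D t \<le> K t \<and> K t \<le> D t + h"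
    "\<And>t. Suc t < T \<Longrightarrow> K (Suc t) < G (Suc t) \<Longrightarrow> K (Suc t) - K t = m"
    "\<And>t. t < T \<Longrightarrow> K t > G t \<Longrightarrow> K (Suc t) - K t = m"
proof -
  define L where "L t = Max ((\<lambda>s. D s - m * (real s - real t)) ` {t..T})" for t
  have L_le: "L t \<le> x" if "t \<le> T" "\<And>s. t \<le> s \<Longrightarrow> s \<le> T \<Longrightarrow> D s - m * (real s - real t) \<le> x" for t x
    unfolding L_def using that by (subst Max_le_iff) auto
  have L_ge: "D s - m * (real s - real t) \<le> L t" if "t \<le> s" "s \<le> T" for s t
    unfolding L_def using that by (intro Max_ge) auto
  have L_D: "D t \<le> L t" if "t \<le> T" for t using L_ge[of t t] that by simp
  have LT: "L T = D T" unfolding L_def by simp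
  have L0: "L 0 \<le> 0" using cap0 by (intro L_le) auto
  have L_h: "L t \<le> D t + h" if "t \<le> T" for t
    using that cap by (intro L_le) (auto simp: algebra_simps)
  have L_slope: "L (Suc t) \<le> L t + m" if "t < T" for t
  proof (rule L_le)
    fix s assume "Suc t \<le> s" "s \<le> T"
    then show "D s - m * (real s - real (Suc t)) \<le> L t + m"
      using L_ge[of t s] by (simp add: algebra_simps)
  qed (use that in simp)
  \<comment> \<open>Either the maximum defining \<open>L t\<close> is attained at
    \<open>s = t\<close>, or it comes from a later \<open>s\<close>, and then one step towards
    \<open>s\<close> raises \<open>L\<close> by \<open>m\<close>.\<close>
  have L_unfold: "L t \<le> max (D t) (L (Suc t) - m)" if "t < T" for t
  proof (rule L_le)
    fix s assume s: "t \<le> s" "s \<le> T"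
    show "D s - m * (real s - real t) \<le> max (D t) (L (Suc t) - m)"
    proof (cases "s = t")
      case False
      then show ?thesis using s L_ge[of "Suc t" s] by (simp add: algebra_simps)
    qed simp
  qed (use that in simp)
  have L_mono: "L t \<le> L (Suc t)" if "t < T" for t
    using L_unfold[OF that] D_mono[OF that] L_D[of "Suc t"] that m by simp

  define H where "H t = max (G t) (L t)" for t
  have H_mono: "H t \<le> H (Suc t)" if "t < T" for t
    using G_mono[OF that] L_mono[OF that] unfolding H_def by linarith
  \<comment> \<open>The greedy recursion produces the greatest path from 0 with slope at most
    \<open>m\<close> below \<open>H\<close>. As \<open>L\<close> starts at or below 0, has slope at
    most \<open>m\<close> and lies below \<open>H\<close>, it stays below \<open>K\<close>.\<close>
  define K where "K = rec_nat 0 (\<lambda>t k. min (k + m) (H (Suc t)))"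
  have K0: "K 0 = 0" and K_Suc: "K (Suc t) = min (K t + m) (H (Suc t))" for t
    by (simp_all add: K_def)
  have K_H: "K t \<le> H t" for t
    by (cases t) (simp_all add: K0 K_Suc H_def G0)
  have K_L: "L t \<le> K t" if "t \<le> T" for t
    using that
  proof (induction t)
    case (Suc t)
    then show ?case using L_slope[of t] by (simp add: K_Suc H_def)
  qed (simp add: K0 L0)
  have KT: "K T = D T" using K_L[of T] K_H[of T] by (simp add: H_def LT GT)
  have K_incr: "0 \<le> K (Suc t) - K t" "K (Suc t) - K t \<le> m" if "t < T" for t
    using K_H[of t] H_mono[OF that] m by (simp_all add: K_Suc)
  have K_tube: "D t \<le> K t" "K t \<le> D t + h" if "t \<le> T" for t
    using L_D[OF that] K_L[OF that] K_H[of t] L_h[OF that] tube[OF that] unfolding H_def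
    by linarith+
  have below: "K (Suc t) - K t = m" if "K (Suc t) < G (Suc t)" for t
    using that unfolding K_Suc H_def by linarith
  \<comment> \<open>Since \<open>K\<close> lies between \<open>L\<close> and \<open>max G L\<close>,
    exceeding \<open>G t\<close> forces \<open>K t = L t > G t \<ge> D t\<close>. So
    \<open>L\<close> rises by at least \<open>m\<close> in the next step, and \<open>K\<close>,
    which stays above \<open>L\<close>, must follow.\<close>
  have above: "K (Suc t) - K t = m" if "t < T" "K t > G t" for t
  proof -
    have "L t > G t" "K t = L t" using that K_H[of t] K_L[of t] unfolding H_def by linarith+
    moreover have "D t \<le> G t" using tube[of t] that by simp
    ultimately have "L t \<le> L (Suc t) - m" using L_unfold[OF that(1)] by linarith
    then show ?thesis using \<open>K t = L t\<close> K_L[of "Suc t"] K_incr(2)[of t] that by simp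
  qed
  show ?thesis
    using that[of K] K0 KT K_incr K_tube below above by blast
qed

section \<open>Cost comparison by subgradients\<close>

lemma strictly_convex_on_imp_convex_on:
  assumes "strictly_convex_on S c"
  shows "convex_on S c"
proof (rule convex_onI)
  fix u x y :: real assume *: "0 < u" "u < 1" "x \<in> S" "y \<in> S"
  show "c ((1 - u) *\<^sub>R x + u *\<^sub>R y) \<le> (1 - u) * c x + u * c y"
  proof (cases "x = y")
    case True
    then show ?thesis by (simp add: algebra_simps)
  next
    case False
    then show ?thesis using assms * unfolding strictly_convex_on_def by fastforce
  qed
qed (use assms in \<open>simp add: strictly_convex_on_def\<close>)

lemma exists_mono_subgradient:
  fixes c :: "real \<Rightarrow> real"
  assumes "convex_on {0..} c" and "mono_on {0..} c"
  obtains \<phi> where "\<And>x y. x \<ge> 0 \<Longrightarrow> y \<ge> 0 \<Longrightarrow> c x - c y \<ge> \<phi> y * (x - y)"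
    and "mono_on {0..} \<phi>"
proof -
  have "\<exists>p. \<forall>x\<ge>0. c x - c y \<ge> p * (x - y)" if "y \<ge> 0" for y
  proof (cases "y = 0")
    \<comment> \<open>The endpoint 0 is not interior, and convexity alone could allow slope
      \<open>-\<infinity>\<close> there; monotonicity makes 0 a subgradient.\<close>
    case True
    then show ?thesis using assms(2) by (intro exI[of _ 0]) (auto simp: mono_on_def)
  next
    case False
    then have "y \<in> interior {0..}" using that by simp
    from convex_le_Inf_differential[OF assms(1) this] show ?thesis
      by (intro exI[of _ "Inf ((\<lambda>t. (c y - c t) / (y - t)) ` ({y<..} \<inter> {0..}))"])
        (auto simp: algebra_simps)
  qed
  then obtain \<phi> where \<phi>: "\<And>x y. y \<ge> 0 \<Longrightarrow> x \<ge> 0 \<Longrightarrow> c x - c y \<ge> \<phi> y * (x - y)"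
    by metis
  have "\<phi> x \<le> \<phi> y" if "0 \<le> x" "x \<le> y" for x y
  proof (cases "x = y")
    case False
    \<comment> \<open>Sum of the subgradient inequalities at \<open>x\<close> and at
      \<open>y\<close>.\<close>
    have "\<phi> x * (y - x) + \<phi> y * (x - y) \<le> 0" using \<phi>[of x y] \<phi>[of y x] that by simp
    then have "(\<phi> x - \<phi> y) * (y - x) \<le> 0" by (simp add: algebra_simps)
    then show ?thesis using that False by (simp add: mult_le_0_iff)
  qed simp
  then show ?thesis using that[of \<phi>] \<phi> by (auto simp: mono_on_def)
qed

lemma capped_path_cost_le:
  fixes c :: "real \<Rightarrow> real" and G K :: "nat \<Rightarrow> real"
  assumes c: "convex_on {0..} c" "mono_on {0..} c"
    and ends: "G 0 = 0" "K 0 = 0" "K T = G T"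
    and G_mono: "\<And>t. t < T \<Longrightarrow> G t \<le> G (Suc t)"
    and K_incr: "\<And>t. t < T \<Longrightarrow> 0 \<le> K (Suc t) - K t \<and> K (Suc t) - K t \<le> m"
    and below: "\<And>t. Suc t < T \<Longrightarrow> K (Suc t) < G (Suc t) \<Longrightarrow> K (Suc t) - K t = m"
    and above: "\<And>t. t < T \<Longrightarrow> K t > G t \<Longrightarrow> K (Suc t) - K t = m"
  shows "(\<Sum>t<T. c (K (Suc t) - K t)) \<le> (\<Sum>t<T. c (G (Suc t) - G t))"
proof (cases T)
  case (Suc n)
  obtain \<phi> where \<phi>: "\<And>x y. x \<ge> 0 \<Longrightarrow> y \<ge> 0 \<Longrightarrow> c x - c y \<ge> \<phi> y * (x - y)"
    and \<phi>_mono: "mono_on {0..} \<phi>"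
    using exists_mono_subgradient[OF c] by blast
  define a where "a t = \<phi> (K (Suc t) - K t)" for t
  define e where "e t = G t - K t" for t
  \<comment> \<open>Where \<open>K\<close> is below \<open>G\<close>, the preceding increment of
    \<open>K\<close> is the maximal \<open>m\<close>, so \<open>a\<close> cannot increase; where
    \<open>K\<close> is above \<open>G\<close>, the following one is \<open>m\<close>, so
    \<open>a\<close> cannot decrease. Both factors thus agree in sign.\<close>
  have "0 \<le> (a t - a (Suc t)) * e (Suc t)" if "t < n" for t
  proof -
    have t: "t < T" "Suc t < T" using that Suc by auto
    note k = K_incr[OF t(1)] K_incr[OF t(2)]
    consider "K (Suc t) < G (Suc t)" | "K (Suc t) > G (Suc t)" | "K (Suc t) = G (Suc t)"
      by linarith
    then show ?thesis
    proof cases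
      case 1
      then have "a (Suc t) \<le> a t"
        using below[OF t(2) 1] k unfolding a_def by (intro mono_onD[OF \<phi>_mono]) auto
      then show ?thesis using 1 by (simp add: e_def)
    next
      case 2
      then have "a t \<le> a (Suc t)"
        using above[OF t(2) 2] k unfolding a_def by (intro mono_onD[OF \<phi>_mono]) auto
      then show ?thesis using 2 by (simp add: e_def mult_nonpos_nonpos)
    qed (simp add: e_def)
  qed
  then have "0 \<le> (\<Sum>t<n. (a t - a (Suc t)) * e (Suc t))" by (intro sum_nonneg) auto
  \<comment> \<open>The boundary term vanishes because \<open>G\<close> and \<open>K\<close> agree
    at \<open>T\<close>.\<close>
  also have "\<dots> = (\<Sum>t<T. a t * (e (Suc t) - e t))"
    using sum_by_parts[of e a n] ends unfolding Suc by (simp add: e_def)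
  also have "\<dots> \<le> (\<Sum>t<T. c (G (Suc t) - G t) - c (K (Suc t) - K t))"
  proof (rule sum_mono)
    fix t assume "t \<in> {..<T}"
    then show "a t * (e (Suc t) - e t) \<le> c (G (Suc t) - G t) - c (K (Suc t) - K t)"
      using \<phi>[of "G (Suc t) - G t" "K (Suc t) - K t"] G_mono[of t] K_incr[of t]
      by (simp add: a_def e_def algebra_simps)
  qed
  finally show ?thesis by (simp add: sum_subtractf)
qed simp

section \<open>Necessity of the capacity bound\<close>

text \<open>Summing the power balance shows that cumulative generation minus cumulative demand is
  the total stored energy, which lies between 0 and \<open>b1 + b2 \<le> h\<close>.\<close>

lemma feasible_set_total_storage:
  assumes "(g, r1, r2, b1, b2) \<in> feasible_set T d2 gbar f h" and "t \<le> T" and "h \<ge> 0"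
  shows "storage_level d2 t \<le> storage_level g t"
    and "storage_level g t \<le> storage_level d2 t + h"
    and "storage_level g T = storage_level d2 T"
proof -
  have bal: "storage_level g i = storage_level d2 i + storage_level r1 i + storage_level r2 i"
    if "i \<le> T" for i
  proof -
    have "storage_level g i = storage_level (\<lambda>t. (d2 t + r1 t) + r2 t) i"
      using that assms(1) by (intro storage_level_cong[of T]) (auto simp: feasible_set_def algebra_simps)
    then show ?thesis by (simp only: storage_level_add)
  qed
  have "0 \<le> storage_level r1 t + storage_level r2 t \<and> storage_level r1 t + storage_level r2 t \<le> h"
  proof (cases "t = 0")
    case False
    then have "t \<in> {1..T}" using assms by simp
    then show ?thesis using assms(1) unfolding feasible_set_def storage_ok_def by force
  qed (use assms in simp)
  with bal[OF assms(2)] show "storage_level d2 t \<le> storage_level g t"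
    "storage_level g t \<le> storage_level d2 t + h" by linarith+
  show "storage_level g T = storage_level d2 T"
    using bal[of T] assms(1) by (simp add: feasible_set_def storage_ok_def)
qed

lemma feasible_imp_f_min_le:
  assumes "T \<ge> 1" "h \<ge> 0" and x: "(g, r1, r2, b1, b2) \<in> feasible_set T d2 gbar f h"
  shows "f_min T d2 h \<le> min gbar f"
proof -
  \<comment> \<open>One estimate serves both capacities: \<open>p\<close> is the generation for
    \<open>gbar\<close> and the line flow for \<open>f\<close>. The flow also stays in the tube,
    since it exceeds demand by what enters the load storage alone.\<close>
  have *: "f_min T d2 h \<le> y"
    if "\<And>i. i \<in> {1..T} \<Longrightarrow> p i \<le> y"
      and p: "\<And>t. t \<le> T \<Longrightarrow> storage_level d2 t \<le> storage_level p t"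
        "\<And>t. t \<le> T \<Longrightarrow> storage_level p t \<le> storage_level d2 t + h" for p y
  proof -
    have le: "storage_level p t - storage_level p s \<le> y * (real t - real s)" if "s \<le> t" "t \<le> T" for s t
      using that \<open>\<And>i. i \<in> {1..T} \<Longrightarrow> p i \<le> y\<close> by (intro storage_level_diff_le) auto
    have "storage_level d2 t \<le> y * real t" if "t \<in> {1..T}" for t
      using le[of 0 t] p(1)[of t] that by simp
    moreover have "storage_level d2 t - storage_level d2 s - h \<le> y * (real t - real s)"
      if "s < t" "t \<le> T" for s t
      using le[of s t] p(1)[of t] p(2)[of s] that by simp
    ultimately show ?thesis unfolding f_min_le_iff[OF assms(1)] by blast
  qed
  have "f_min T d2 h \<le> gbar"
    using x feasible_set_total_storage[OF x _ assms(2)]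
    by (intro *[of g]) (auto simp: feasible_set_def)
  moreover have "f_min T d2 h \<le> f"
  proof (rule *[of "\<lambda>t. d2 t + r2 t"])
    show "d2 i + r2 i \<le> f" if "i \<in> {1..T}" for i
      using x that unfolding feasible_set_def by force
    have r2: "0 \<le> storage_level r2 t \<and> storage_level r2 t \<le> h" if "t \<le> T" for t
    proof (cases "t = 0")
      case False
      then have "t \<in> {1..T}" using that by simp
      then show ?thesis using x unfolding feasible_set_def storage_ok_def by force
    qed (use assms in simp)
    show "storage_level d2 t \<le> storage_level (\<lambda>t. d2 t + r2 t) t"
      "storage_level (\<lambda>t. d2 t + r2 t) t \<le> storage_level d2 t + h" if "t \<le> T" for t
      using r2[OF that] by (simp_all add: storage_level_add)
  qed
  ultimately show ?thesis by simp
qed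

lemma feasible_set_mono:
  assumes "gbar \<le> gbar'" "f \<le> f'"
  shows "feasible_set T d2 gbar f h \<subseteq> feasible_set T d2 gbar' f' h"
  using assms unfolding feasible_set_def by fastforce

section \<open>Reduction to capacity \<open>f_min\<close>\<close>

text \<open>The capacities \<open>gbar\<close> and \<open>f\<close> of the given decision are
  arbitrary, so the lemma yields both feasibility at \<open>f_min\<close> and the cost
  bound.\<close>

lemma exists_f_min_decision:
  assumes T: "T \<ge> 1" and h: "h \<ge> 0" and d2: "\<And>t. t \<in> {1..T} \<Longrightarrow> d2 t \<ge> 0"
    and c: "convex_on {0..} c" "mono_on {0..} c"
    and x: "(g, r1, r2, b1, b2) \<in> feasible_set T d2 gbar f h"
  obtains k q1 q2 a1 a2
  where "(k, q1, q2, a1, a2) \<in> feasible_set T d2 (f_min T d2 h) (f_min T d2 h) h"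
    and "(\<Sum>t=1..T. c (k t)) \<le> (\<Sum>t=1..T. c (g t))"
proof -
  let ?m = "f_min T d2 h" and ?D = "storage_level d2" and ?G = "storage_level g"
  have m: "?m \<ge> 0" using f_min_nonneg T d2[of 1] by simp
  have g: "g t \<ge> 0" if "t \<in> {1..T}" for t using x that by (simp add: feasible_set_def)
  have cap0: "?D t \<le> ?m * real t" if "t \<le> T" for t
    using f_min_le_iff[OF T, of d2 h ?m] that by (cases "t = 0") auto
  \<comment> \<open>The pairs with \<open>s = 0\<close> or \<open>s = t\<close>, absent from
    \<open>f_min\<close>, follow from \<open>cap0\<close> and \<open>h \<ge> 0\<close>.\<close>
  have cap: "?D t - ?D s - h \<le> ?m * (real t - real s)" if "s \<le> t" "t \<le> T" for s t
  proof -
    consider "s = 0" | "s = t" | "1 \<le> s" "s < t" using \<open>s \<le> t\<close> by linarith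
    then show ?thesis
    proof cases
      case 1
      then show ?thesis using cap0[of t] that h by simp
    next
      case 3
      then show ?thesis using f_min_le_iff[OF T, of d2 h ?m] that by blast
    qed (use h in simp)
  qed
  have D_mono: "?D t \<le> ?D (Suc t)" and G_mono: "?G t \<le> ?G (Suc t)" if "t < T" for t
    using that d2 g by simp_all
  have tube: "?D t \<le> ?G t \<and> ?G t \<le> ?D t + h" if "t \<le> T" for t
    using feasible_set_total_storage[OF x that h] by simp
  have GT: "?G T = ?D T" using feasible_set_total_storage(3)[OF x _ h] by blast
  obtain K where K: "K 0 = 0" "K T = ?D T"
    "\<And>t. t < T \<Longrightarrow> 0 \<le> K (Suc t) - K t \<and> K (Suc t) - K t \<le> ?m"
    "\<And>t. t \<le> T \<Longrightarrow> ?D t \<le> K t \<and> K t \<le> ?D t + h"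
    "\<And>t. Suc t < T \<Longrightarrow> K (Suc t) < ?G (Suc t) \<Longrightarrow> K (Suc t) - K t = ?m"
    "\<And>t. t < T \<Longrightarrow> K t > ?G t \<Longrightarrow> K (Suc t) - K t = ?m"
    using capped_path_in_tube[OF m storage_level_0 D_mono cap0 cap storage_level_0 G_mono tube GT]
    by blast
  let ?k = "\<lambda>t. K t - K (t - 1)"
  have k: "0 \<le> ?k t \<and> ?k t \<le> ?m" if "t \<in> {1..T}" for t
    using K(3)[of "t - 1"] that by (cases t) simp_all
  have "(\<Sum>t<T. c (K (Suc t) - K t)) \<le> (\<Sum>t<T. c (?G (Suc t) - ?G t))"
    using capped_path_cost_le[OF c storage_level_0 K(1) _ G_mono K(3,5,6)] K(2) GT by simp
  then have cost: "(\<Sum>t=1..T. c (?k t)) \<le> (\<Sum>t=1..T. c (g t))"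
    by (simp add: sum.atLeast1_atMost_eq)
  have "storage_level (\<lambda>t. ?k t - d2 t) t = K t - ?D t" for t
    using storage_level_diff[of ?k d2] storage_level_increments[of K, OF K(1)] by simp
  moreover have "0 \<le> K t - ?D t \<and> K t - ?D t \<le> h" if "t \<le> T" for t
    using K(4)[OF that] by simp
  \<comment> \<open>With no storage at the generator, the line carries exactly the generation
    \<open>?k\<close>, so the same cap covers both; the load storage holds
    \<open>K - D\<close>.\<close>
  ultimately have "(?k, \<lambda>_. 0, \<lambda>t. ?k t - d2 t, 0, h) \<in> feasible_set T d2 ?m ?m h"
    using k K(2) h by (auto simp: feasible_set_def storage_ok_def storage_level_def[of "\<lambda>_. 0"])
  then show ?thesis using that cost by blast
qed

theorem proposition2:
  fixes T :: nat and d2 :: "nat \<Rightarrow> real" and c1 :: "real \<Rightarrow> real"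
    and gbar1 f12 h :: real
  assumes "T \<ge> 1"
    and "gbar1 \<ge> 0" and "f12 \<ge> 0" and "h \<ge> 0"
    and "\<And>t. t \<in> {1..T} \<Longrightarrow> d2 t \<ge> 0"
    and "\<And>x. x \<ge> 0 \<Longrightarrow> c1 x \<ge> 0"
    and "mono_on {0..} c1"
    and "strictly_convex_on {0..} c1"
  shows "(feasible T d2 gbar1 f12 h \<longleftrightarrow> min gbar1 f12 \<ge> f_min T d2 h) \<and>
    (min gbar1 f12 \<ge> f_min T d2 h \<longrightarrow>
       opt_value T d2 c1 gbar1 f12 h = opt_value T d2 c1 (f_min T d2 h) (f_min T d2 h) h)"
proof -
  let ?m = "f_min T d2 h"
  have c: "convex_on {0..} c1" using assms(8) by (rule strictly_convex_on_imp_convex_on)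
  note reduce = exists_f_min_decision[OF assms(1,4,5) c assms(7)]
  \<comment> \<open>Capacities equal to total demand let each period be served directly without
    storage. Reducing this decision shows that the problem at \<open>f_min\<close> is
    feasible.\<close>
  have unconstrained: "(d2, \<lambda>_. 0, \<lambda>_. 0, 0, 0) \<in> feasible_set T d2 (\<Sum>t=1..T. d2 t) (\<Sum>t=1..T. d2 t) h"
    using assms(4,5) member_le_sum[of _ "{1..T}" d2]
    by (auto simp: feasible_set_def storage_ok_def storage_level_def)
  have "feasible_set T d2 ?m ?m h \<noteq> {}"
    using reduce[OF _ unconstrained] by blast
  moreover have mono: "feasible_set T d2 ?m ?m h \<subseteq> feasible_set T d2 gbar1 f12 h" if "?m \<le> min gbar1 f12"
    using that by (intro feasible_set_mono) auto
  moreover have "?m \<le> min gbar1 f12" if "feasible T d2 gbar1 f12 h"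
    using that feasible_imp_f_min_le[OF assms(1,4)] unfolding feasible_def by fast
  ultimately have "feasible T d2 gbar1 f12 h \<longleftrightarrow> ?m \<le> min gbar1 f12"
    unfolding feasible_def by blast
  moreover have "opt_value T d2 c1 gbar1 f12 h = opt_value T d2 c1 ?m ?m h" if "?m \<le> min gbar1 f12"
  proof (rule antisym)
    show "opt_value T d2 c1 gbar1 f12 h \<le> opt_value T d2 c1 ?m ?m h"
      unfolding opt_value_def using mono[OF that] by (rule INF_superset_mono) simp
    show "opt_value T d2 c1 ?m ?m h \<le> opt_value T d2 c1 gbar1 f12 h"
      unfolding opt_value_def
    proof (rule INF_mono, clarify)
      fix g r1 r2 b1 b2 assume "(g, r1, r2, b1, b2) \<in> feasible_set T d2 gbar1 f12 h"
      from reduce[OF _ this] obtain k q1 q2 a1 a2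
        where "(k, q1, q2, a1, a2) \<in> feasible_set T d2 ?m ?m h"
          and "(\<Sum>t=1..T. c1 (k t)) \<le> (\<Sum>t=1..T. c1 (g t))" by blast
      then show "\<exists>x\<in>feasible_set T d2 ?m ?m h.
          (case x of (g1, r1, r2, b1, b2) \<Rightarrow> ereal (\<Sum>t=1..T. c1 (g1 t))) \<le> ereal (\<Sum>t=1..T. c1 (g t))"
        by (intro bexI[of _ "(k, q1, q2, a1, a2)"]) simp_all
    qed
  qed
  ultimately show ?thesis by blast
qed

end
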